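(* Let $F$, $f$, $z_1,\dots,z_n$ and $\mu(f,t)$ be as in the context, let $t\ge 1$ be real and let $\tilde f\in[f]_{\mu(f,t)}$. Then: (i) for every $i=1,\dots,n$, the open disc $\Delta_i$ of radius $\sigma(z_i,f)/(tn)$ centered at $z_i$ contains the root $z_i$ of $f$ and a corresponding root $\tilde z_i$ of $\tilde f$; (ii) for every $z\in\mathbb{C}\setminus\bigcup_{i=1}^n\Delta_i$ it holds that $|f(z)|>(n+1)\mu(f,t)$.
   Context: Let $F(x)=\sum_{i=0}^nA_ix^i\in\mathbb{R}[x]$ be a square-free polynomial of degree $n\ge 2$ with real coefficients and $|A_n|\ge1$, with complex roots $\xi_1,\dots,\xi_n$. Let $\Gamma_F:=\log_2\max_i|\xi_i|$ and let $\Gamma$ be an integer with $\Gamma_F\le\Gamma<4\log_2 n+\Gamma_F$. Define $f(x)=\sum_{i=0}^na_ix^i:=F(2^{\Gamma+1}x)/A_n$, with roots $z_1,\dots,z_n$ (so $z_i=\xi_i/2^{\Gamma+1}$ and all $|z_i|\le 1/2$). For a root $z_i$, its separation $\sigma(z_i,f)$ is the minimal distance $|z_i-z_j|$ over roots $z_j\neq z_i$. For real $t\ge1$, $\mu(f,t):=\frac1t\min_{i=1,\dots,n}\left|\frac{\sigma(z_i,f)f'(z_i)}{8n^2}\right|$. For $\mu\ge 0$, $[f]_\mu$ is the set of polynomials $\tilde f=\sum_{i=0}^n\tilde a_ix^i\in\mathbb{C}[x]$ with $|a_i-\tilde a_i|\le\mu$ for all $i$. *)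

theory Defs
  imports
    "HOL-Analysis.Analysis"
    "HOL-Computational_Algebra.Squarefree"
begin

definition scaled_poly :: "real poly \<Rightarrow> int \<Rightarrow> complex poly" where
  "scaled_poly F \<Gamma> =
     map_poly complex_of_real
       (smult (1 / lead_coeff F) (pcompose F [:0, 2 powi (\<Gamma> + 1):]))"

(* Meaningful for polynomials with at least two distinct roots, so that the minimum
   ranges over a finite nonempty set. *)
definition separation :: "complex \<Rightarrow> complex poly \<Rightarrow> real" where
  "separation z f = Min {cmod (z - w) | w. poly f w = 0 \<and> w \<noteq> z}"

definition mu :: "complex poly \<Rightarrow> real \<Rightarrow> real" where
  "mu f t = 1 / t *
     Min {cmod (of_real (separation z f) * poly (pderiv f) z / of_nat (8 * (degree f)\<^sup>2))
          | z. poly f z = 0}"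

definition approx_polys :: "complex poly \<Rightarrow> real \<Rightarrow> complex poly set" where
  "approx_polys f \<mu> =
     {g. degree g \<le> degree f \<and> (\<forall>i\<le>degree f. cmod (coeff f i - coeff g i) \<le> \<mu>)}"

end

theory Submission
  imports Defs
    "HOL-Complex_Analysis.Conformal_Mappings"
    "HOL-Computational_Algebra.Fundamental_Theorem_Algebra"
begin

text \<open>
  On the circle bounding \<open>\<Delta>\<^sub>i\<close> the factors of \<open>f\<close> are comparable with those of \<open>f' (z\<^sub>i)\<close>:
  \<open>\<bar>w - z\<^sub>j\<bar> \<ge> (1 - 1/n) \<bar>z\<^sub>i - z\<^sub>j\<bar>\<close> for \<open>j \<noteq> i\<close>, and \<open>(1 - 1/n) ^ (n - 1) \<ge> 1/e \<ge> 1/3\<close>, whence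
  \<open>\<bar>f w\<bar> \<ge> (n + 3) \<mu>\<close>. The maximum modulus principle for \<open>1/f\<close> on the complement of the discs
  gives (ii). All discs lie in the unit disc, so \<open>f\<close> and its perturbation differ by at most
  \<open>(n + 1) \<mu>\<close> on the circles, and by less than \<open>2 \<mu>\<close> at \<open>z\<^sub>i\<close> because \<open>\<bar>z\<^sub>i\<bar> \<le> 1/2\<close>. Hence the
  perturbation is larger on the circle than at its centre, and the maximum modulus principle for
  its reciprocal forces a root in \<open>\<Delta>\<^sub>i\<close>. The discs are disjoint, so counting roots makes the
  correspondence bijective.

  Distinctness of the complex roots follows from square-freeness over the reals because the square
  of the real minimal polynomial of a double root would divide \<open>F\<close>.
\<close>

section \<open>Real polynomials at complex points\<close>

lemma map_poly_of_real_mult: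
  "map_poly complex_of_real (p * q) = map_poly complex_of_real p * map_poly complex_of_real q"
  by (intro poly_eqI) (simp add: coeff_map_poly coeff_mult)

lemma poly_map_poly_of_real:
  "poly (map_poly complex_of_real p) (complex_of_real x) = complex_of_real (poly p x)"
  by (induction p) (simp_all add: map_poly_pCons)

text \<open>Here \<open>q\<close> is the minimal polynomial of \<open>w\<close> over the reals:
  linear for real \<open>w\<close>, otherwise the product of the factors for \<open>w\<close> and
  its conjugate. The condition on \<open>h\<close> records that \<open>w\<close> is only a simple
  zero of \<open>q\<close>.\<close>

lemma real_minimal_poly:
  fixes w :: complex
  obtains q h where "map_poly complex_of_real q = [:- w, 1:] * h" "poly h w \<noteq> 0" "\<not> q dvd 1"
    "\<And>p. poly (map_poly complex_of_real p) w = 0 \<Longrightarrow> q dvd p"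
proof (cases "Im w = 0")
  case True
  then have w: "w = complex_of_real (Re w)"
    by (simp add: complex_eq_iff)
  show ?thesis
  proof (rule that[of "[:- Re w, 1:]" 1])
    show "map_poly complex_of_real [:- Re w, 1:] = [:- w, 1:] * 1"
      using w by (simp add: map_poly_pCons)
    show "\<not> [:- Re w, 1:] dvd 1"
      by (simp add: is_unit_poly_iff)
    fix p assume "poly (map_poly complex_of_real p) w = 0"
    then have "poly p (Re w) = 0"
      using poly_map_poly_of_real[of p "Re w"] w by simp
    then show "[:- Re w, 1:] dvd p"
      by (simp add: poly_eq_0_iff_dvd)
  qed simp
next
  case False
  define q where "q = [:(Re w)\<^sup>2 + (Im w)\<^sup>2, - 2 * Re w, 1:]"
  have q: "map_poly complex_of_real q = [:- w, 1:] * [:- cnj w, 1:]"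
    by (simp add: q_def map_poly_pCons complex_eq_iff power2_eq_square)
  show ?thesis
  proof (rule that[OF q])
    show "poly [:- cnj w, 1:] w \<noteq> 0"
      using False by (simp add: complex_eq_iff)
    show "\<not> q dvd 1"
      by (simp add: q_def is_unit_poly_iff)
    fix p assume p: "poly (map_poly complex_of_real p) w = 0"
    define r where "r = p mod q"
    \<comment> \<open>The remainder modulo the quadratic \<open>q\<close> is a real polynomial
      \<open>a + b x\<close>, which still vanishes at \<open>w\<close> whenever \<open>p\<close>
      does.\<close>
    have "degree r < 2"
      using degree_mod_less'[of q p] by (cases "r = 0") (auto simp: r_def q_def)
    then have "r = [:coeff r 0, coeff r 1:]"
      by (intro poly_eqI) (auto simp: coeff_pCons coeff_eq_0 split: nat.splits)
    then obtain a b where ab: "r = [:a, b:]"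
      by blast
    have pq: "p = q * (p div q) + r"
      by (simp add: r_def)
    have "map_poly complex_of_real p = map_poly complex_of_real q * map_poly complex_of_real (p div q)
            + map_poly complex_of_real r"
      unfolding map_poly_of_real_mult[symmetric]
      by (subst pq, intro poly_eqI) (simp add: coeff_map_poly)
    then have "poly (map_poly complex_of_real p) w =
        poly ([:- w, 1:] * [:- cnj w, 1:]) w * poly (map_poly complex_of_real (p div q)) w
          + poly (map_poly complex_of_real r) w"
      by (simp only: q poly_add poly_mult)
    then have "poly (map_poly complex_of_real r) w = 0"
      using p by simp
    \<comment> \<open>The imaginary part of \<open>a + b w\<close> is \<open>b * Im w\<close>, and
      \<open>Im w\<close> is nonzero, so \<open>b\<close> vanishes first and then
      \<open>a\<close>.\<close>
    then have "b = 0 \<and> a = 0"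
      using False by (auto simp: ab map_poly_pCons complex_eq_iff)
    then have "p mod q = 0"
      using ab by (simp add: r_def)
    then show "q dvd p"
      by (simp add: mod_eq_0_iff_dvd)
  qed
qed

lemma squarefree_real_no_double_root:
  assumes "squarefree F"
  shows "\<not> [:- w, 1:] ^ 2 dvd map_poly complex_of_real F"
proof
  assume "[:- w, 1:] ^ 2 dvd map_poly complex_of_real F"
  then obtain H where H: "map_poly complex_of_real F = [:- w, 1:] * ([:- w, 1:] * H)"
    by (metis dvdE power2_eq_square mult.assoc)
  obtain q h where q: "map_poly complex_of_real q = [:- w, 1:] * h" "poly h w \<noteq> 0" "\<not> q dvd 1"
    "\<And>p. poly (map_poly complex_of_real p) w = 0 \<Longrightarrow> q dvd p"
    using real_minimal_poly[of w] by blast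
  have "q dvd F"
    by (rule q(4)) (simp add: H)
  then obtain g where g: "F = q * g" ..
  have "[:- w, 1:] * (h * map_poly complex_of_real g) = [:- w, 1:] * ([:- w, 1:] * H)"
    using H by (simp only: g map_poly_of_real_mult q(1) mult.assoc)
  then have "h * map_poly complex_of_real g = [:- w, 1:] * H"
    by (subst (asm) mult_cancel_left) simp
  \<comment> \<open>After one factor is cancelled, a zero at \<open>w\<close> remains. It cannot
    come from \<open>h\<close>, so it comes from \<open>g\<close>, which is a real polynomial and
    hence again divisible by \<open>q\<close>.\<close>
  then have "poly h w * poly (map_poly complex_of_real g) w = 0"
    by (metis poly_mult poly_eq_0_iff_dvd dvd_triv_left)
  then have "q dvd g"
    using q(2,4) by simp
  then have "q ^ 2 dvd F"
    by (simp add: g power2_eq_square mult_dvd_mono)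
  then show False
    using assms q(3) by (auto simp: squarefree_def)
qed

section \<open>Minimum modulus\<close>

text \<open>Since \<open>p\<close> has no zero on \<open>S\<close>, its reciprocal is holomorphic
  inside and continuous up to the boundary, and the maximum modulus principle bounds it by
  \<open>inverse B\<close>.\<close>

lemma poly_minimum_modulus_frontier:
  fixes p :: "complex poly"
  assumes "bounded S" "closed S" and nz: "\<And>w. w \<in> S \<Longrightarrow> poly p w \<noteq> 0"
    and B: "0 < B" "\<And>w. w \<in> frontier S \<Longrightarrow> B \<le> cmod (poly p w)" and "w \<in> S"
  shows "B \<le> cmod (poly p w)"
proof -
  have "cmod (inverse (poly p w)) \<le> inverse B"
  proof (rule maximum_modulus_frontier[where f = "\<lambda>w. inverse (poly p w)" and S = S])
    show "(\<lambda>w. inverse (poly p w)) holomorphic_on interior S"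
      using nz interior_subset by (intro holomorphic_intros) auto
    show "continuous_on (closure S) (\<lambda>w. inverse (poly p w))"
      using nz \<open>closed S\<close> by (intro continuous_intros) auto
    fix v assume "v \<in> frontier S"
    then show "cmod (inverse (poly p v)) \<le> inverse B"
      using B by (simp add: norm_inverse le_imp_inverse_le)
  qed fact+
  then show ?thesis
    using nz[OF \<open>w \<in> S\<close>] B(1) by (simp add: norm_inverse inverse_le_iff_le)
qed

text \<open>As 1 - 1/n is the reciprocal of 1 + 1/(n-1), the claim is the reciprocal of (1 +
  1/(n-1))^(n-1) \<le> e \<le> 3.\<close>

lemma one_minus_inverse_power_ge:
  assumes "n \<ge> 2"
  shows "(1 - 1 / real n) ^ (n - 1) \<ge> 1 / 3"
proof -
  have "(1 + 1 / real (n - 1)) ^ (n - 1) \<le> exp (1 / real (n - 1)) ^ (n - 1)"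
    by (intro power_mono exp_ge_add_one_self) auto
  also have "\<dots> = exp 1"
    using assms by (simp flip: exp_of_nat_mult)
  also have "\<dots> \<le> 3"
    by (rule exp_le)
  finally have "(1 + 1 / real (n - 1)) ^ (n - 1) \<le> 3" .
  moreover have "1 - 1 / real n = inverse (1 + 1 / real (n - 1))"
    using assms by (simp add: field_simps of_nat_diff)
  moreover have "(1 + 1 / real (n - 1)) ^ (n - 1) > 0"
    by (intro zero_less_power) (simp add: add_pos_nonneg)
  ultimately have "inverse 3 \<le> (1 - 1 / real n) ^ (n - 1)"
    by (simp only: power_inverse) (rule le_imp_inverse_le)
  then show ?thesis
    by (simp add: inverse_eq_divide)
qed

section \<open>Polynomials with simple roots\<close>

text \<open>The leading coefficient \<open>c\<close> is left free because substituting a multiple of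
  x into a normalised polynomial makes it non-monic.\<close>

locale simple_roots_poly =
  fixes n :: nat and c :: complex and z :: "nat \<Rightarrow> complex" and f :: "complex poly"
  assumes n: "n \<ge> 2" and c: "c \<noteq> 0" and inj: "inj_on z {1..n}"
    and f: "f = smult c (\<Prod>i=1..n. [:- z i, 1:])"
begin

lemma poly_f: "poly f w = c * (\<Prod>i=1..n. w - z i)"
  by (simp add: f poly_prod)

lemma roots_f: "{w. poly f w = 0} = z ` {1..n}"
  using c by (auto simp: poly_f)

lemma degree_f: "degree f = n"
  using c by (simp add: f degree_prod_eq_sum_degree)

lemma poly_f_remove:
  assumes "i \<in> {1..n}"
  shows "poly f w = c * (w - z i) * (\<Prod>j\<in>{1..n}-{i}. w - z j)"
  using assms by (simp add: poly_f prod.remove[of _ i])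

lemma poly_pderiv_f:
  assumes "i \<in> {1..n}"
  shows "poly (pderiv f) (z i) = c * (\<Prod>j\<in>{1..n}-{i}. z i - z j)"
proof -
  have "f = [:- z i, 1:] * smult c (\<Prod>j\<in>{1..n}-{i}. [:- z j, 1:])"
    using assms by (simp add: f prod.remove[of _ i])
  then have "poly (pderiv f) (z i) = poly (smult c (\<Prod>j\<in>{1..n}-{i}. [:- z j, 1:])) (z i)"
    by (simp only: pderiv_mult) (simp add: pderiv_pCons)
  then show ?thesis
    by (simp add: poly_prod)
qed

lemma poly_pderiv_f_nonzero:
  assumes "i \<in> {1..n}"
  shows "poly (pderiv f) (z i) \<noteq> 0"
  using assms c by (auto simp: poly_pderiv_f dest: inj_onD[OF inj])

text \<open>Indexing by the other roots shows that the minimum in \<open>separation\<close> is over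
  a finite set, nonempty because n \<ge> 2. Injectivity of \<open>z\<close> makes "another root" and
  "another index" the same.\<close>

lemma separation_set:
  assumes "i \<in> {1..n}"
  shows "{cmod (z i - w) | w. poly f w = 0 \<and> w \<noteq> z i} = (\<lambda>j. cmod (z i - z j)) ` ({1..n} - {i})"
proof -
  have "{cmod (z i - w) | w. poly f w = 0 \<and> w \<noteq> z i}
      = (\<lambda>w. cmod (z i - w)) ` ({w. poly f w = 0} - {z i})"
    by auto
  also have "{w. poly f w = 0} - {z i} = z ` ({1..n} - {i})"
    unfolding roots_f using assms inj_on_image_set_diff[OF inj, of "{1..n}" "{i}"] by simp
  finally show ?thesis
    by (simp add: image_image)
qed

lemma separation_le:
  assumes "i \<in> {1..n}" "j \<in> {1..n}" "i \<noteq> j"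
  shows "separation (z i) f \<le> cmod (z i - z j)"
  unfolding separation_def separation_set[OF assms(1)] using assms by (intro Min_le) auto

lemma ex_other_index:
  assumes "i \<in> {1..n}"
  obtains j where "j \<in> {1..n}" "j \<noteq> i"
  using assms n that[of 1] that[of 2] by (cases "i = 1") auto

lemma separation_pos:
  assumes "i \<in> {1..n}"
  shows "separation (z i) f > 0"
proof -
  obtain j where j: "j \<in> {1..n}" "j \<noteq> i"
    using ex_other_index[OF assms] .
  then have ne: "{1..n} - {i} \<noteq> {}"
    by blast
  show ?thesis
    unfolding separation_def separation_set[OF assms]
    using ne assms by (subst Min_gr_iff) (auto dest: inj_onD[OF inj])
qed

lemma mu_altdef:
  "mu f t = 1 / t * Min ((\<lambda>i. separation (z i) f * cmod (poly (pderiv f) (z i)) / (8 * (real n)\<^sup>2)) ` {1..n})"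
proof -
  have "{cmod (of_real (separation v f) * poly (pderiv f) v / of_nat (8 * (degree f)\<^sup>2)) | v. poly f v = 0}
     = (\<lambda>v. cmod (of_real (separation v f) * poly (pderiv f) v / of_nat (8 * (degree f)\<^sup>2))) ` z ` {1..n}"
    unfolding roots_f[symmetric] by auto
  also have "\<dots> = (\<lambda>i. separation (z i) f * cmod (poly (pderiv f) (z i)) / (8 * (real n)\<^sup>2)) ` {1..n}"
    unfolding image_image degree_f
    by (intro image_cong refl) (use separation_pos in \<open>simp add: norm_mult norm_divide norm_power less_imp_le\<close>)
  finally show ?thesis
    by (simp add: mu_def)
qed

lemma mu_pos:
  assumes "t \<ge> 1"
  shows "mu f t > 0"
proof -
  have "{1..n} \<noteq> {}"
    using n by auto
  then show ?thesis
    unfolding mu_altdef using assms n separation_pos poly_pderiv_f_nonzero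
    by (intro mult_pos_pos) (auto simp: Min_gr_iff)
qed

lemma mu_le:
  assumes "t \<ge> 1" "i \<in> {1..n}"
  shows "mu f t \<le> separation (z i) f * cmod (poly (pderiv f) (z i)) / (8 * t * (real n)\<^sup>2)"
proof -
  have "mu f t \<le> 1 / t * (separation (z i) f * cmod (poly (pderiv f) (z i)) / (8 * (real n)\<^sup>2))"
    unfolding mu_altdef using assms by (intro mult_left_mono Min_le) auto
  then show ?thesis
    by (simp add: mult_ac)
qed

text \<open>The factor n + 3 leaves a surplus of 2 mu over the n + 1 that a perturbation can consume
  on the circle. This surplus drives the root argument and also makes the bound outside the discs
  strict.\<close>

lemma circle_bound:
  assumes t: "t \<ge> 1" and i: "i \<in> {1..n}" and w: "dist (z i) w = separation (z i) f / (t * real n)"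
  shows "(real n + 3) * mu f t \<le> cmod (poly f w)"
proof -
  define s where "s = separation (z i) f"
  define P where "P = (\<Prod>j\<in>{1..n}-{i}. cmod (z i - z j))"
  define D where "D = cmod (poly (pderiv f) (z i))"
  have s: "s > 0"
    using separation_pos[OF i] by (simp add: s_def)
  have D: "D = cmod c * P"
    by (simp add: D_def P_def poly_pderiv_f[OF i] norm_mult prod_norm)
  have "real n \<le> t * real n"
    using t n by simp
  then have rn: "s / (t * real n) \<le> s / real n"
    using s n by (intro divide_left_mono) auto
  have card: "card ({1..n} - {i}) = n - 1"
    using i by simp
  have "(\<Prod>j\<in>{1..n}-{i}. (1 - 1 / real n) * cmod (z i - z j)) \<le> (\<Prod>j\<in>{1..n}-{i}. cmod (w - z j))"
  proof (rule prod_mono, intro conjI)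
    fix j assume j: "j \<in> {1..n} - {i}"
    show "0 \<le> (1 - 1 / real n) * cmod (z i - z j)"
      using n by simp
    \<comment> \<open>The radius is at most \<open>s / n\<close>, hence at most a fraction 1/n of
      the distance from \<open>z i\<close> to \<open>z j\<close>; the triangle inequality then gives
      the lower bound for each factor.\<close>
    have "s \<le> cmod (z i - z j)"
      unfolding s_def using i j by (intro separation_le) auto
    then have "s / real n \<le> cmod (z i - z j) / real n"
      by (intro divide_right_mono) auto
    moreover have "cmod (z i - z j) \<le> cmod (z i - w) + cmod (w - z j)"
      using norm_triangle_ineq[of "z i - w" "w - z j"] by simp
    ultimately show "(1 - 1 / real n) * cmod (z i - z j) \<le> cmod (w - z j)"
      using rn w by (simp add: s_def dist_norm algebra_simps)
  qed
  then have "(1 - 1 / real n) ^ (n - 1) * P \<le> (\<Prod>j\<in>{1..n}-{i}. cmod (w - z j))"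
    by (simp only: prod.distrib prod_constant card P_def)
  moreover have "1 / 3 * P \<le> (1 - 1 / real n) ^ (n - 1) * P"
    by (intro mult_right_mono one_minus_inverse_power_ge n) (simp add: P_def prod_nonneg)
  ultimately have "1 / 3 * P \<le> (\<Prod>j\<in>{1..n}-{i}. cmod (w - z j))"
    by linarith
  then have "cmod c * (s / (t * real n)) * (1 / 3 * P) \<le> cmod c * (s / (t * real n)) * (\<Prod>j\<in>{1..n}-{i}. cmod (w - z j))"
    using s t n by (intro mult_left_mono) auto
  also have "\<dots> = cmod (poly f w)"
    using w by (simp add: poly_f_remove[OF i] norm_mult prod_norm s_def dist_norm norm_minus_commute)
  finally have low: "s * D / (3 * t * real n) \<le> cmod (poly f w)"
    by (simp add: D mult_ac)
  have "(real n + 3) * mu f t \<le> (real n + 3) * (s * D / (8 * t * (real n)\<^sup>2))"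
    unfolding s_def D_def by (intro mult_left_mono mu_le t i) auto
  also have "\<dots> = (real n + 3) / (8 * real n) * (s * D / (t * real n))"
    by (simp add: power2_eq_square)
  \<comment> \<open>The constant 8 in \<open>mu\<close> enters here: (n + 3)/(8n) \<le> 1/3 means 9
    \<le> 5n, which holds from n = 2 on.\<close>
  also have "\<dots> \<le> 1 / 3 * (s * D / (t * real n))"
    using n s t by (intro mult_right_mono) (auto simp: field_simps D_def)
  also have "\<dots> = s * D / (3 * t * real n)"
    by simp
  finally show ?thesis
    using low by linarith
qed

text \<open>Since t n \<ge> 2, each radius is at most half the separation, so two radii add up to at
  most the distance of the centres. Open discs may then touch but do not meet.\<close>

lemma discs_disjoint:
  assumes t: "t \<ge> 1" and ij: "i \<in> {1..n}" "j \<in> {1..n}" "i \<noteq> j"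
  shows "ball (z i) (separation (z i) f / (t * real n)) \<inter> ball (z j) (separation (z j) f / (t * real n)) = {}"
proof -
  have half: "separation (z k) f / (t * real n) \<le> separation (z k) f / 2" if "k \<in> {1..n}" for k
  proof -
    have "1 * 2 \<le> t * real n"
      using t n by (intro mult_mono) auto
    then show ?thesis
      using separation_pos[OF that] by (intro divide_left_mono) auto
  qed
  have "separation (z i) f \<le> dist (z i) (z j)" "separation (z j) f \<le> dist (z i) (z j)"
    using separation_le[of i j] separation_le[of j i] ij by (auto simp: dist_norm norm_minus_commute)
  then show ?thesis
    using half[OF ij(1)] half[OF ij(2)] by (intro disjoint_ballI) linarith
qed

lemma outside_discs_bound:
  assumes t: "t \<ge> 1"
    and w: "w \<notin> (\<Union>i\<in>{1..n}. ball (z i) (separation (z i) f / (t * real n)))"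
  shows "(real n + 3) * mu f t \<le> cmod (poly f w)"
proof -
  define r where "r i = separation (z i) f / (t * real n)" for i
  define U where "U = (\<Union>i\<in>{1..n}. ball (z i) (r i))"
  define B where "B = (real n + 3) * mu f t"
  have r: "r i > 0" if "i \<in> {1..n}" for i
    using separation_pos[OF that] t n by (simp add: r_def)
  obtain a p where ap: "f = pCons a p"
    by (cases f)
  moreover have "p \<noteq> 0"
    using degree_f n ap by auto
  ultimately obtain R where R: "\<And>v. R \<le> cmod v \<Longrightarrow> B \<le> cmod (poly f v)"
    using poly_infinity[of p B a] by auto
  \<comment> \<open>The complement of the discs is unbounded, so it is cut off at a radius beyond
    \<open>w\<close> and so large that the growth of \<open>f\<close> gives the bound on the outer
    circle.\<close>
  define M where "M = max R (cmod w) + 1"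
  define S where "S = cball 0 M - U"
  have "open U"
    unfolding U_def by auto
  show ?thesis
    unfolding B_def[symmetric]
  proof (rule poly_minimum_modulus_frontier[of S])
    show "bounded S" "closed S"
      unfolding S_def using \<open>open U\<close> by (auto intro: bounded_subset)
    show "w \<in> S"
      using w by (auto simp: S_def U_def M_def r_def)
    show "B > 0"
      using mu_pos[OF t] by (simp add: B_def)
    show "poly f v \<noteq> 0" if "v \<in> S" for v
    proof
      assume "poly f v = 0"
      then have "v \<in> z ` {1..n}"
        unfolding roots_f[symmetric] by simp
      then obtain i where "i \<in> {1..n}" "v = z i"
        by blast
      then have "v \<in> U"
        using r unfolding U_def by (intro UN_I) auto
      then show False
        using that by (simp add: S_def)
    qed
    fix v assume v: "v \<in> frontier S"
    have "frontier S \<subseteq> frontier (cball 0 M) \<union> frontier U"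
      unfolding S_def Diff_eq using frontier_Int_subset[of "cball 0 M" "- U"] by simp
    then consider "v \<in> frontier (cball 0 M)" | "v \<in> frontier U"
      using v by blast
    then show "B \<le> cmod (poly f v)"
    proof cases
      case 1
      then have "cmod v = M"
        by (auto simp: M_def)
      then show ?thesis
        by (intro R) (simp add: M_def)
    next
      case 2
      \<comment> \<open>A boundary point of the finite union lies in one of the closed discs but in
        none of the open ones, hence on one of the circles.\<close>
      then have "v \<in> closure U" "v \<notin> U"
        using \<open>open U\<close> by (auto simp: frontier_def interior_open)
      moreover have "closure U \<subseteq> (\<Union>i\<in>{1..n}. cball (z i) (r i))"
        unfolding U_def by (intro closure_minimal UN_mono ball_subset_cball closed_UN) auto
      ultimately obtain i where i: "i \<in> {1..n}" "v \<in> cball (z i) (r i)"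
        by blast
      moreover have "v \<notin> ball (z i) (r i)"
        using \<open>v \<notin> U\<close> i(1) unfolding U_def by blast
      ultimately have "dist (z i) v = r i"
        by simp
      then show ?thesis
        unfolding B_def by (intro circle_bound[OF t i(1)]) (simp add: r_def)
    qed
  qed
qed

end

section \<open>Perturbation\<close>

text \<open>The sum of powers is kept because it is estimated twice: by n + 1 on the circles, inside
  the unit disc, and by less than 2 at the centres.\<close>

lemma approx_polys_diff_le:
  assumes "g \<in> approx_polys f \<mu>"
  shows "cmod (poly f w - poly g w) \<le> \<mu> * (\<Sum>k\<le>degree f. cmod w ^ k)"
proof -
  have deg: "degree (f - g) \<le> degree f"
    using assms by (auto simp: approx_polys_def intro: degree_diff_le)
  have "poly f w - poly g w = (\<Sum>k\<le>degree f. coeff (f - g) k * w ^ k)"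
    unfolding poly_diff[symmetric] poly_altdef[of "f - g"] using deg
    by (intro sum.mono_neutral_left) (auto simp: coeff_eq_0 simp del: coeff_diff)
  also have "cmod \<dots> \<le> (\<Sum>k\<le>degree f. \<mu> * cmod w ^ k)"
    using assms by (intro order_trans[OF norm_sum] sum_mono)
      (auto simp: approx_polys_def norm_mult norm_power intro!: mult_right_mono)
  finally show ?thesis
    by (simp add: sum_distrib_left)
qed

lemma sum_powers_half_less:
  assumes "0 \<le> x" "x \<le> 1 / 2"
  shows "(\<Sum>k\<le>n. x ^ k) < (2 :: real)"
proof -
  have "(\<Sum>k\<le>n. x ^ k) \<le> (\<Sum>k\<le>n. (1 / 2) ^ k)"
    using assms by (intro sum_mono power_mono)
  also have "\<dots> = 2 - (1 / 2) ^ n"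
    by (induction n) auto
  also have "\<dots> < 2"
    by simp
  finally show ?thesis .
qed

section \<open>Roots of the perturbed polynomial\<close>

context simple_roots_poly
begin

text \<open>Roots of modulus at most 1/2 are at most 1 apart, and t n \<ge> 2. Together with the
  bound on the centre this keeps every circle in the closed unit disc.\<close>

lemma radius_le_half:
  assumes small: "\<forall>j\<in>{1..n}. cmod (z j) \<le> 1 / 2"
    and t: "t \<ge> 1" and i: "i \<in> {1..n}"
  shows "separation (z i) f / (t * real n) \<le> 1 / 2"
proof -
  obtain j where j: "j \<in> {1..n}" "j \<noteq> i"
    using ex_other_index[OF i] .
  have "separation (z i) f \<le> cmod (z i - z j)"
    using separation_le[OF i j(1)] j(2) by simp
  also have "\<dots> \<le> cmod (z i) + cmod (z j)"
    by (rule norm_triangle_ineq4)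
  also have "\<dots> \<le> 1"
    using bspec[OF small i] bspec[OF small j(1)] by simp
  finally have "separation (z i) f \<le> 1" .
  moreover have "1 * 2 \<le> t * real n"
    using t n by (intro mult_mono) auto
  ultimately show ?thesis
    using separation_pos[OF i] by (intro frac_le) auto
qed

lemma perturbed_circle_bound:
  assumes small: "\<forall>j\<in>{1..n}. cmod (z j) \<le> 1 / 2"
    and t: "t \<ge> 1" and g: "g \<in> approx_polys f (mu f t)" and i: "i \<in> {1..n}"
    and w: "dist (z i) w = separation (z i) f / (t * real n)"
  shows "2 * mu f t \<le> cmod (poly g w)"
proof -
  have "cmod w \<le> cmod (z i) + cmod (w - z i)"
    using norm_triangle_ineq[of "z i" "w - z i"] by simp
  also have "cmod (w - z i) \<le> 1 / 2"
    using w radius_le_half[OF small t i] by (metis dist_norm dist_commute)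
  also have "cmod (z i) + 1 / 2 \<le> 1"
    using bspec[OF small i] by simp
  finally have "(\<Sum>k\<le>degree f. cmod w ^ k) \<le> (\<Sum>k\<le>degree f. 1)"
    by (intro sum_mono power_le_one) auto
  then have "mu f t * (\<Sum>k\<le>degree f. cmod w ^ k) \<le> mu f t * (real n + 1)"
    using mu_pos[OF t] by (intro mult_left_mono) (auto simp: degree_f)
  then have "cmod (poly f w - poly g w) \<le> mu f t * (real n + 1)"
    using approx_polys_diff_le[OF g, of w] by simp
  moreover have "(real n + 3) * mu f t \<le> cmod (poly f w)"
    by (rule circle_bound[OF t i w])
  moreover have "cmod (poly f w) \<le> cmod (poly f w - poly g w) + cmod (poly g w)"
    using norm_triangle_ineq[of "poly f w - poly g w" "poly g w"] by simp
  ultimately show ?thesis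
    by (simp add: algebra_simps)
qed

text \<open>This takes the place of Rouche's theorem: only the existence of a root in each disc is
  shown, and multiplicities are left to the later count.\<close>

lemma root_in_disc:
  assumes small: "\<forall>j\<in>{1..n}. cmod (z j) \<le> 1 / 2"
    and t: "t \<ge> 1" and g: "g \<in> approx_polys f (mu f t)" and i: "i \<in> {1..n}"
  shows "\<exists>w \<in> ball (z i) (separation (z i) f / (t * real n)). poly g w = 0"
proof (rule ccontr)
  define r where "r = separation (z i) f / (t * real n)"
  define \<mu> where "\<mu> = mu f t"
  assume "\<not> ?thesis"
  then have no: "poly g w \<noteq> 0" if "dist (z i) w < r" for w
    using that by (auto simp: r_def)
  have \<mu>: "\<mu> > 0"
    unfolding \<mu>_def by (rule mu_pos[OF t])
  have r: "r > 0"
    using separation_pos[OF i] t n by (simp add: r_def)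
  have circle: "2 * \<mu> \<le> cmod (poly g w)" if "dist (z i) w = r" for w
    using perturbed_circle_bound[OF small t g i] that by (simp add: r_def \<mu>_def)
  have "2 * \<mu> \<le> cmod (poly g (z i))"
  proof (rule poly_minimum_modulus_frontier[of "cball (z i) r"])
    fix w assume "w \<in> cball (z i) r"
    then show "poly g w \<noteq> 0"
      using no[of w] circle[of w] \<mu> by (cases "dist (z i) w < r") auto
  qed (use r \<mu> circle in auto)
  \<comment> \<open>Strictness is essential: the circle bound is only the weak inequality with the
    same constant, and it comes from the truncated geometric series staying below 2.\<close>
  moreover have "cmod (poly g (z i)) < 2 * \<mu>"
  proof -
    have "poly f (z i) = 0"
      using roots_f i by blast
    then have "cmod (poly g (z i)) \<le> \<mu> * (\<Sum>k\<le>degree f. cmod (z i) ^ k)"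
      using approx_polys_diff_le[OF g, of "z i"] by (simp add: \<mu>_def)
    also have "\<dots> < \<mu> * 2"
      using \<mu> bspec[OF small i] by (intro mult_strict_left_mono sum_powers_half_less) auto
    finally show ?thesis
      by simp
  qed
  ultimately show False
    by simp
qed

text \<open>Disjoint discs give n distinct roots, and the degree of \<open>g\<close> is at most n,
  so no further roots exist and all of them are hit.\<close>

lemma root_correspondence:
  assumes small: "\<forall>j\<in>{1..n}. cmod (z j) \<le> 1 / 2"
    and t: "t \<ge> 1" and g: "g \<in> approx_polys f (mu f t)"
  shows "\<exists>zt. bij_betw zt {1..n} {w. poly g w = 0} \<and>
           (\<forall>i\<in>{1..n}. zt i \<in> ball (z i) (separation (z i) f / (t * real n)))"
proof -
  obtain zt where zt: "\<And>i. i \<in> {1..n} \<Longrightarrow>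
      zt i \<in> ball (z i) (separation (z i) f / (t * real n)) \<and> poly g (zt i) = 0"
    using root_in_disc[OF small t g] by metis
  have inj_zt: "inj_on zt {1..n}"
    using discs_disjoint[OF t] zt by (intro inj_onI) (metis disjoint_iff)
  \<comment> \<open>The root count needs a nonzero polynomial. Any point of a circle is a witness;
    the one to the right of \<open>z 1\<close> is taken.\<close>
  have "g \<noteq> 0"
  proof
    assume "g = 0"
    have one: "1 \<in> {1..n}"
      using n by simp
    define w where "w = z 1 + of_real (separation (z 1) f / (t * real n))"
    have "dist (z 1) w = separation (z 1) f / (t * real n)"
      using separation_pos[OF one] t by (simp add: w_def dist_norm norm_divide norm_mult)
    then have "2 * mu f t \<le> cmod (poly g w)"
      by (rule perturbed_circle_bound[OF small t g one])
    then show False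
      using mu_pos[OF t] \<open>g = 0\<close> by simp
  qed
  have "card {w. poly g w = 0} \<le> card (zt ` {1..n})"
    unfolding card_image[OF inj_zt] using card_poly_roots_bound[OF \<open>g \<noteq> 0\<close>] g
    by (simp add: approx_polys_def degree_f)
  then have "zt ` {1..n} = {w. poly g w = 0}"
    using zt poly_roots_finite[OF \<open>g \<noteq> 0\<close>] by (intro card_seteq) auto
  then show ?thesis
    using inj_zt zt by (intro exI[of _ zt]) (auto simp: bij_betw_def)
qed

end

section \<open>From the given polynomial to the simple-roots setting\<close>

lemma scaled_poly_factorization:
  assumes "F \<noteq> 0"
    and "map_poly complex_of_real F = smult (complex_of_real (lead_coeff F)) (\<Prod>i=1..n. [:- \<xi> i, 1:])"
    and "\<And>i. i \<in> {1..n} \<Longrightarrow> z i = \<xi> i / 2 powi (\<Gamma> + 1)"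
  shows "scaled_poly F \<Gamma> = smult ((2 powi (\<Gamma> + 1)) ^ n) (\<Prod>i=1..n. [:- z i, 1:])"
proof -
  define s :: real where "s = 2 powi (\<Gamma> + 1)"
  have s: "complex_of_real s = 2 powi (\<Gamma> + 1)" "s \<noteq> 0"
    by (simp_all add: s_def)
  have "scaled_poly F \<Gamma> = smult (complex_of_real (1 / lead_coeff F))
      (pcompose (map_poly complex_of_real F) [:0, complex_of_real s:])"
    unfolding scaled_poly_def s_def[symmetric]
    by (intro poly_eqI) (simp add: coeff_map_poly coeff_pcompose_linear)
  then have "poly (scaled_poly F \<Gamma>) x = (\<Prod>i=1..n. of_real s * x - \<xi> i)" for x :: complex
    using assms(1) by (simp add: assms(2) poly_pcompose poly_prod mult.commute)
  also have "(\<Prod>i=1..n. of_real s * x - \<xi> i) = (\<Prod>i=1..n. of_real s * (x - z i))" for x :: complex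
    using s by (intro prod.cong refl) (simp add: assms(3) algebra_simps)
  also have "(\<Prod>i=1..n. of_real s * (x - z i)) = of_real s ^ n * (\<Prod>i=1..n. x - z i)" for x :: complex
    by (simp add: prod.distrib)
  finally show ?thesis
    \<comment> \<open>Over the infinite field of complex numbers, agreement of all values gives
      equality of the polynomials.\<close>
    unfolding poly_eq_poly_eq_iff[symmetric] by (intro ext) (simp add: poly_prod s)
qed

lemma scaled_root_le_half:
  assumes "finite A" "i \<in> A" "log 2 (Max ((\<lambda>i. cmod (\<xi> i)) ` A)) \<le> of_int \<Gamma>"
  shows "cmod (\<xi> i / 2 powi (\<Gamma> + 1)) \<le> 1 / 2"
\<comment> \<open>A nonzero root makes the maximum positive, which is required to turn the bound on
  its logarithm into a bound by a power of 2.\<close>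
proof (cases "\<xi> i = 0")
  case False
  have le: "cmod (\<xi> i) \<le> Max ((\<lambda>i. cmod (\<xi> i)) ` A)"
    using assms by (intro Max_ge) auto
  with False have "0 < Max ((\<lambda>i. cmod (\<xi> i)) ` A)"
    by (smt (verit) zero_less_norm_iff)
  then have "Max ((\<lambda>i. cmod (\<xi> i)) ` A) \<le> 2 powr of_int \<Gamma>"
    using assms(3) by (simp add: log_le_iff)
  with le have "cmod (\<xi> i) \<le> 2 powi \<Gamma>"
    by (simp add: powr_real_of_int')
  then show ?thesis
    by (simp add: norm_divide norm_power_int power_int_add divide_simps)
qed simp

lemma squarefree_roots_inj:
  assumes "squarefree F"
    and "map_poly complex_of_real F = smult a (\<Prod>i\<in>A. [:- \<xi> i, 1:])" "finite A"
  shows "inj_on \<xi> A"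
proof (rule inj_onI, rule ccontr)
  fix i j assume ij: "i \<in> A" "j \<in> A" "\<xi> i = \<xi> j" "i \<noteq> j"
  have "(\<Prod>k\<in>A. [:- \<xi> k, 1:]) = [:- \<xi> i, 1:] * ([:- \<xi> j, 1:] * (\<Prod>k\<in>A - {i} - {j}. [:- \<xi> k, 1:]))"
    using ij assms(3) by (simp add: prod.remove[of A i] prod.remove[of "A - {i}" j])
  then have "(\<Prod>k\<in>A. [:- \<xi> k, 1:]) = [:- \<xi> i, 1:] ^ 2 * (\<Prod>k\<in>A - {i} - {j}. [:- \<xi> k, 1:])"
    by (simp only: ij(3) power2_eq_square mult.assoc)
  then have "[:- \<xi> i, 1:] ^ 2 dvd (\<Prod>k\<in>A. [:- \<xi> k, 1:])"
    by (rule dvdI)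
  then show False
    using squarefree_real_no_double_root[OF assms(1), of "\<xi> i"] assms(2) by (auto intro: dvd_smult)
qed

theorem theorem3:
  fixes F :: "real poly" and n :: nat and \<xi> z :: "nat \<Rightarrow> complex"
    and \<Gamma> :: int and \<Gamma>\<^sub>F t :: real and f ft :: "complex poly" and \<Delta> :: "nat \<Rightarrow> complex set"
  assumes "degree F = n" and "n \<ge> 2" and "squarefree F" and "\<bar>lead_coeff F\<bar> \<ge> 1"
    and "map_poly complex_of_real F =
           smult (complex_of_real (lead_coeff F)) (\<Prod>i=1..n. [:- \<xi> i, 1:])"
    and "\<Gamma>\<^sub>F = log 2 (Max ((\<lambda>i. cmod (\<xi> i)) ` {1..n}))"
    and "\<Gamma>\<^sub>F \<le> of_int \<Gamma>" and "of_int \<Gamma> < 4 * log 2 (real n) + \<Gamma>\<^sub>F"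
    and "f = scaled_poly F \<Gamma>"
    and "\<And>i. i \<in> {1..n} \<Longrightarrow> z i = \<xi> i / 2 powi (\<Gamma> + 1)"
    and "t \<ge> 1"
    and "ft \<in> approx_polys f (mu f t)"
    and "\<And>i. i \<in> {1..n} \<Longrightarrow> \<Delta> i = ball (z i) (separation (z i) f / (t * real n))"
  shows "(\<exists>zt. bij_betw zt {1..n} {w. poly ft w = 0} \<and>
            (\<forall>i\<in>{1..n}. poly f (z i) = 0 \<and> z i \<in> \<Delta> i \<and> zt i \<in> \<Delta> i)) \<and>
         (\<forall>w. w \<notin> (\<Union>i\<in>{1..n}. \<Delta> i) \<longrightarrow> cmod (poly f w) > (real n + 1) * mu f t)"
proof -
  let ?c = "(2 powi (\<Gamma> + 1)) ^ n :: complex"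
  have F0: "F \<noteq> 0"
    using assms(1,2) by auto
  have inj_\<xi>: "inj_on \<xi> {1..n}"
    using squarefree_roots_inj[OF assms(3,5)] by simp
  have "inj_on z {1..n}"
  proof (rule inj_onI)
    fix i j assume ij: "i \<in> {1..n}" "j \<in> {1..n}" "z i = z j"
    then have "\<xi> i = \<xi> j"
      using assms(10)[OF ij(1)] assms(10)[OF ij(2)] by simp
    then show "i = j"
      using inj_onD[OF inj_\<xi>] ij by blast
  qed
  moreover have "f = smult ?c (\<Prod>i=1..n. [:- z i, 1:])"
    unfolding assms(9) by (rule scaled_poly_factorization[OF F0 assms(5,10)])
  ultimately interpret simple_roots_poly n ?c z f
    using assms(2) by unfold_locales auto
  have small: "\<forall>i\<in>{1..n}. cmod (z i) \<le> 1 / 2"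
  proof
    fix i assume i: "i \<in> {1..n}"
    show "cmod (z i) \<le> 1 / 2"
      unfolding assms(10)[OF i]
      by (rule scaled_root_le_half[OF _ i]) (use assms(6,7) in auto)
  qed
  obtain zt where zt: "bij_betw zt {1..n} {w. poly ft w = 0}"
      "\<And>i. i \<in> {1..n} \<Longrightarrow> zt i \<in> \<Delta> i"
    using root_correspondence[OF small assms(11,12)] assms(13) by metis
  have "poly f (z i) = 0 \<and> z i \<in> \<Delta> i" if "i \<in> {1..n}" for i
    using that roots_f separation_pos[OF that] assms(2,11) by (auto simp: assms(13))
  moreover have "(real n + 1) * mu f t < cmod (poly f w)" if "w \<notin> (\<Union>i\<in>{1..n}. \<Delta> i)" for w
  proof -
    \<comment> \<open>Positivity of \<open>mu f t\<close> turns the surplus 2 mu into the strict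
      inequality.\<close>
    have "(real n + 1) * mu f t < (real n + 3) * mu f t"
      using mu_pos[OF assms(11)] by simp
    also have "\<dots> \<le> cmod (poly f w)"
      using that assms(13) by (intro outside_discs_bound[OF assms(11)]) auto
    finally show ?thesis .
  qed
  ultimately show ?thesis
    using zt by blast
qed

end
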